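(* Let $n\geq 3$ be a natural number, $R$ a commutative ring and $\sigma\in O_{2n}(R)$. Let $i,j,k,l\in\Omega$ with $i\neq\pm j$ and $k\neq\pm l$. Then (i) $T_{kl}(\sigma_{ij})$ is a product of $8$ elementary orthogonal $\sigma$-conjugates, (ii) $T_{kl}(\sigma_{i,-i})$ is a product of $16$ elementary orthogonal $\sigma$-conjugates, (iii) $T_{kl}(\sigma_{ii}-\sigma_{jj})$ is a product of $24$ elementary orthogonal $\sigma$-conjugates, and (iv) $T_{kl}(\sigma_{ii}-\sigma_{-i,-i})$ is a product of $48$ elementary orthogonal $\sigma$-conjugates.
   Context: Rings are associative with $1\neq 0$. Let $\Omega:=\{1,\dots,n,-n,\dots,-1\}$. Rows and columns of $2n\times 2n$ matrices and coordinates of columns in $V:=R^{2n}$ are indexed by $\Omega$ in the order $1,\dots,n,-n,\dots,-1$ (so for $-n\leq i\leq -1$ the index $i$ refers to position $2n+1+i$). Let $p\in M_n(R)$ be the matrix with ones on the skew diagonal and zeros elsewhere, and let $q:V\to R$, $q(v)=v^t\begin{pmatrix}0&p\\0&0\end{pmatrix}v$. The even-dimensional orthogonal group is $O_{2n}(R):=\{\sigma\in GL_{2n}(R)\mid q(\sigma v)=q(v)\ \forall v\in V\}$. Let $e$ be the identity matrix and $e^{ij}$ ($i,j\in\Omega$) the matrix with $1$ at position $(i,j)$ and zeros elsewhere; $\sigma_{ij}$ is the entry of $\sigma$ at position $(i,j)$. For $i,j\in\Omega$ with $i\neq\pm j$ and $x\in R$, the elementary orthogonal transvection is $T_{ij}(x):=e+xe^{ij}-xe^{-j,-i}\in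 O_{2n}(R)$. $EO_{2n}(R)$ is the subgroup of $O_{2n}(R)$ generated by all elementary orthogonal transvections. For group elements $g,h$ put ${}^hg:=hgh^{-1}$. An elementary orthogonal $\sigma$-conjugate is a matrix of the form ${}^{\epsilon}\sigma$ or ${}^{\epsilon}(\sigma^{-1})$ with $\epsilon\in EO_{2n}(R)$ (different factors of a product may use different $\epsilon$ and different signs). *)

theory Defs
  imports "Jordan_Normal_Form.Matrix" "HOL-Algebra.Generated_Groups"
begin

text \<open>The commutative ring is the carrier of a type of class \<^class>\<open>comm_ring_1\<close>; this class
  includes $0 \neq 1$. Matrices and columns are those of the library, whose rows and
  columns are numbered from 0.\<close>

definition Omega :: "nat \<Rightarrow> int set" where
  "Omega n = {1..int n} \<union> {- int n..-1}"

text \<open>The position, counted from 0, of an index in the ordering $1, \dots, n, -n, \dots, -1$.\<close>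

definition pos :: "nat \<Rightarrow> int \<Rightarrow> nat" where
  "pos n i = nat (if i > 0 then i - 1 else 2 * int n + i)"

definition entry :: "nat \<Rightarrow> 'a mat \<Rightarrow> int \<Rightarrow> int \<Rightarrow> 'a" where
  "entry n A i j = A $$ (pos n i, pos n j)"

definition matrix_unit :: "nat \<Rightarrow> int \<Rightarrow> int \<Rightarrow> 'a::comm_ring_1 mat" where
  "matrix_unit n i j =
     mat (2 * n) (2 * n) (\<lambda>(r, c). if r = pos n i \<and> c = pos n j then 1 else 0)"

definition skew_diag :: "nat \<Rightarrow> 'a::comm_ring_1 mat" where
  "skew_diag n = mat n n (\<lambda>(r, c). if r + c = n - 1 then 1 else 0)"

definition quad_form :: "nat \<Rightarrow> 'a::comm_ring_1 vec \<Rightarrow> 'a" where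
  "quad_form n v =
     v \<bullet> (four_block_mat (0\<^sub>m n n) (skew_diag n) (0\<^sub>m n n) (0\<^sub>m n n) *\<^sub>v v)"

definition GL_group :: "nat \<Rightarrow> 'a::comm_ring_1 mat monoid" where
  "GL_group m = units_of (ring_mat TYPE('a) m ())"

definition O_group :: "nat \<Rightarrow> 'a::comm_ring_1 mat monoid" where
  "O_group n = (GL_group (2 * n))
     \<lparr>carrier := {\<sigma> \<in> carrier (GL_group (2 * n)).
        \<forall>v \<in> carrier_vec (2 * n). quad_form n (\<sigma> *\<^sub>v v) = quad_form n v}\<rparr>"

lemma GL_group_group: "group (GL_group m :: 'a::comm_ring_1 mat monoid)"
  unfolding GL_group_def by (rule monoid.units_group[OF ring.is_monoid[OF ring_mat]])

lemma GL_group_carrierD: "A \<in> carrier (GL_group m) \<Longrightarrow> A \<in> carrier_mat m m"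
  by (simp add: GL_group_def units_of_def Units_def ring_mat_simps)

lemma GL_group_simps: "A \<otimes>\<^bsub>GL_group m\<^esub> B = A * B" "\<one>\<^bsub>GL_group m\<^esub> = 1\<^sub>m m"
  by (simp_all add: GL_group_def units_of_def ring_mat_simps)

lemma O_group_subgroup: "subgroup (carrier (O_group n)) (GL_group (2 * n) :: 'a::comm_ring_1 mat monoid)"
proof -
  interpret group "GL_group (2 * n) :: 'a mat monoid" by (rule GL_group_group)
  show ?thesis
  proof (rule subgroupI)
    show "carrier (O_group n) \<subseteq> carrier (GL_group (2 * n) :: 'a mat monoid)"
      by (auto simp: O_group_def)
    have "\<one>\<^bsub>GL_group (2 * n)\<^esub> \<in> (carrier (O_group n) :: 'a mat set)"
      unfolding O_group_def using one_closed by (auto simp: GL_group_simps)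
    then show "carrier (O_group n) \<noteq> ({} :: 'a mat set)" by auto
  next
    fix A :: "'a mat" assume A: "A \<in> carrier (O_group n)"
    let ?B = "inv\<^bsub>GL_group (2 * n)\<^esub> A"
    have G: "A \<in> carrier (GL_group (2*n))" using A by (auto simp: O_group_def)
    note cA = GL_group_carrierD[OF G] and cB = GL_group_carrierD[OF inv_closed[OF G]]
    have AB: "A * ?B = 1\<^sub>m (2*n)" using r_inv[OF G] by (simp add: GL_group_simps)
    have "quad_form n (?B *\<^sub>v v) = quad_form n v" if v: "v \<in> carrier_vec (2*n)" for v
    proof -
      have "quad_form n (A *\<^sub>v (?B *\<^sub>v v)) = quad_form n (?B *\<^sub>v v)"
        using A cB v by (auto simp: O_group_def)
      moreover have "A *\<^sub>v (?B *\<^sub>v v) = v"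
        using assoc_mult_mat_vec[OF cA cB v] AB v by simp
      ultimately show ?thesis by simp
    qed
    then show "?B \<in> carrier (O_group n)" using inv_closed[OF G] by (auto simp: O_group_def)
  next
    fix A B :: "'a mat" assume A: "A \<in> carrier (O_group n)" and B: "B \<in> carrier (O_group n)"
    have G: "A \<in> carrier (GL_group (2*n))" "B \<in> carrier (GL_group (2*n))" using A B by (auto simp: O_group_def)
    note cA = GL_group_carrierD[OF G(1)] and cB = GL_group_carrierD[OF G(2)]
    show "A \<otimes>\<^bsub>GL_group (2 * n)\<^esub> B \<in> carrier (O_group n)"
      using A B m_closed[OF G] cA cB by (auto simp: O_group_def GL_group_simps)
  qed
qed

lemma O_group_group: "group (O_group n)"
  using group.subgroup_imp_group[OF GL_group_group O_group_subgroup] by (simp add: O_group_def)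

definition transvection :: "nat \<Rightarrow> int \<Rightarrow> int \<Rightarrow> 'a::comm_ring_1 \<Rightarrow> 'a mat" where
  "transvection n i j x =
     1\<^sub>m (2 * n) + x \<cdot>\<^sub>m matrix_unit n i j - x \<cdot>\<^sub>m matrix_unit n (- j) (- i)"

definition EO :: "nat \<Rightarrow> 'a::comm_ring_1 mat set" where
  "EO n = generate (O_group n)
     {transvection n i j x | i j x. i \<in> Omega n \<and> j \<in> Omega n \<and> i \<noteq> j \<and> i \<noteq> - j}"

definition conj_by :: "('a, 'b) monoid_scheme \<Rightarrow> 'a \<Rightarrow> 'a \<Rightarrow> 'a" where
  "conj_by G g h = g \<otimes>\<^bsub>G\<^esub> h \<otimes>\<^bsub>G\<^esub> inv\<^bsub>G\<^esub> g"

definition elem_conjugates :: "nat \<Rightarrow> 'a::comm_ring_1 mat \<Rightarrow> 'a mat set" where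
  "elem_conjugates n \<sigma> =
     {conj_by (O_group n) \<epsilon> \<sigma> | \<epsilon>. \<epsilon> \<in> EO n} \<union>
     {conj_by (O_group n) \<epsilon> (inv\<^bsub>O_group n\<^esub> \<sigma>) | \<epsilon>. \<epsilon> \<in> EO n}"

text \<open>The number of factors is exact, and the factors may repeat.\<close>

definition is_product_of_elem_conjugates ::
  "nat \<Rightarrow> nat \<Rightarrow> 'a::comm_ring_1 mat \<Rightarrow> 'a mat \<Rightarrow> bool" where
  "is_product_of_elem_conjugates n m \<sigma> A \<longleftrightarrow>
     (\<exists>gs. length gs = m \<and> set gs \<subseteq> elem_conjugates n \<sigma> \<and>
        A = foldr (\<otimes>\<^bsub>O_group n\<^esub>) gs \<one>\<^bsub>O_group n\<^esub>)"

end

theory Submission imports Defs begin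

text \<open>For indices \<open>i, j, d\<close> no two of which are equal or opposite, put
  \<open>t = T\<^sub>j\<^sub>,\<^sub>-\<^sub>d(\<sigma>\<^sub>i\<^sub>i) T\<^sub>d\<^sub>,\<^sub>-\<^sub>i(\<sigma>\<^sub>i\<^sub>j) T\<^sub>i\<^sub>,\<^sub>-\<^sub>j(\<sigma>\<^sub>i\<^sub>d)\<close>. Then
  \<open>\<rho> = \<sigma> t \<sigma>\<^sup>-\<^sup>1\<close> fixes \<open>e\<^sub>-\<^sub>i\<close>, so it normalizes the abelian unipotent radical \<open>U\<close> of the stabilizer
  of \<open>e\<^sub>-\<^sub>i\<close>. The commutator of \<open>t \<rho>\<^sup>-\<^sup>1\<close> with \<open>T\<^sub>-\<^sub>i\<^sub>,\<^sub>-\<^sub>j(1) \<in> U\<close> is, up to conjugation, an element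
  of \<open>U\<close> times the commutator of \<open>t\<close> with \<open>T\<^sub>-\<^sub>i\<^sub>,\<^sub>-\<^sub>j(1)\<close>, which is essentially
  \<open>T\<^sub>j\<^sub>,\<^sub>-\<^sub>d(\<sigma>\<^sub>i\<^sub>j)\<close>; a further commutator with \<open>T\<^sub>-\<^sub>i\<^sub>,\<^sub>j(1) \<in> U\<close> removes the factor in \<open>U\<close> and leaves
  \<open>T\<^sub>-\<^sub>i\<^sub>,\<^sub>-\<^sub>d(\<sigma>\<^sub>i\<^sub>j)\<close>. Each of the three commutators doubles the number of conjugates, and all
  transvections with the same parameter are conjugate under the elementary group. The
  remaining cases apply this to the entries of \<open>\<sigma>\<close> conjugated by \<open>T\<^sub>j\<^sub>i(1)\<close>.\<close>

subsection \<open>Indexing by \<open>Omega\<close>\<close>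

lemma Omega_uminus [simp]: "- i \<in> Omega n \<longleftrightarrow> i \<in> Omega n"
  by (auto simp: Omega_def)

lemma Omega_nonzero: "i \<in> Omega n \<Longrightarrow> i \<noteq> 0"
  by (auto simp: Omega_def)

lemma zero_notin_Omega [simp]: "0 \<notin> Omega n"
  by (simp add: Omega_def)

lemma uminus_neq_Omega [simp]: "i \<in> Omega n \<Longrightarrow> - i \<noteq> i" "i \<in> Omega n \<Longrightarrow> i \<noteq> - i"
  by (auto simp: Omega_def)

lemma finite_Omega [simp]: "finite (Omega n)"
  by (simp add: Omega_def)

lemma pos_less: "i \<in> Omega n \<Longrightarrow> pos n i < 2 * n"
  by (auto simp: Omega_def pos_def)

lemma pos_eq_iff [simp]: "i \<in> Omega n \<Longrightarrow> j \<in> Omega n \<Longrightarrow> pos n i = pos n j \<longleftrightarrow> i = j"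
  by (auto simp: Omega_def pos_def split: if_splits)

lemma pos_image: "pos n ` Omega n = {0..<2 * n}"
proof
  show "{0..<2 * n} \<subseteq> pos n ` Omega n"
  proof
    fix r assume r: "r \<in> {0..<2 * n}"
    show "r \<in> pos n ` Omega n"
    proof (cases "r < n")
      case True
      then show ?thesis
        by (intro image_eqI[of _ _ "int r + 1"]) (auto simp: pos_def Omega_def)
    next
      case False
      then show ?thesis using r
        by (intro image_eqI[of _ _ "int r - 2 * int n"]) (auto simp: pos_def Omega_def)
    qed
  qed
qed (auto simp: pos_less)

lemma bij_betw_pos: "bij_betw (pos n) (Omega n) {0..<2 * n}"
  by (auto simp: bij_betw_def inj_on_def pos_image)

lemma sum_Omega: "(\<Sum>r = 0..<2 * n. f r) = (\<Sum>i\<in>Omega n. f (pos n i))"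
  by (rule sum.reindex_bij_betw[OF bij_betw_pos, symmetric])

lemma sum_Omega_split: "(\<Sum>i\<in>Omega n. f i) = (\<Sum>i\<in>{1..int n}. f i + f (- i))"
proof -
  have "(\<Sum>i\<in>Omega n. f i) = (\<Sum>i\<in>{1..int n}. f i) + (\<Sum>i\<in>{- int n..-1}. f i)"
    unfolding Omega_def by (rule sum.union_disjoint) auto
  also have "(\<Sum>i\<in>{- int n..-1}. f i) = (\<Sum>i\<in>{1..int n}. f (- i))"
    by (rule sum.reindex_bij_betw[symmetric]) (rule bij_betwI[where g = uminus], auto)
  finally show ?thesis by (simp add: sum.distrib)
qed

text \<open>Two absolute values cannot exhaust 1, 2 and 3. This is where \<open>n \<ge> 3\<close>
  enters the proof.\<close>

lemma exists_Omega_avoiding: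
  assumes "n \<ge> 3"
  obtains d where "d \<in> Omega n" "d \<noteq> i" "d \<noteq> - i" "d \<noteq> j" "d \<noteq> - j"
proof -
  have "{1, 2, 3} - {\<bar>i\<bar>, \<bar>j\<bar>} \<noteq> {}"
    by (cases "\<bar>i\<bar> = 1"; cases "\<bar>j\<bar> = 1"; cases "\<bar>i\<bar> = 2"; cases "\<bar>j\<bar> = 2") auto
  then obtain d where "d \<in> {1, 2, 3}" "d \<noteq> \<bar>i\<bar>" "d \<noteq> \<bar>j\<bar>" by blast
  then show thesis using assms by (intro that[of d]) (auto simp: Omega_def)
qed

lemma eq_mat_entryI:
  assumes "A \<in> carrier_mat (2 * n) (2 * n)" "B \<in> carrier_mat (2 * n) (2 * n)"
    and eq: "\<And>r c. r \<in> Omega n \<Longrightarrow> c \<in> Omega n \<Longrightarrow> entry n A r c = entry n B r c"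
  shows "A = B"
proof (rule eq_matI)
  fix r c assume "r < dim_row B" "c < dim_col B"
  then have "r \<in> pos n ` Omega n" "c \<in> pos n ` Omega n" using assms by (auto simp: pos_image)
  then show "A $$ (r, c) = B $$ (r, c)" using eq by (auto simp: entry_def)
qed (use assms in auto)

lemma entry_mult:
  fixes A B :: "'a::comm_ring_1 mat"
  assumes "A \<in> carrier_mat (2 * n) (2 * n)" "B \<in> carrier_mat (2 * n) (2 * n)"
    and "r \<in> Omega n" "c \<in> Omega n"
  shows "entry n (A * B) r c = (\<Sum>s\<in>Omega n. entry n A r s * entry n B s c)"
  using assms pos_less[OF assms(3)] pos_less[OF assms(4)]
  by (auto simp: entry_def scalar_prod_def sum_Omega pos_less intro!: sum.cong)

lemma entry_one [simp]:
  "r \<in> Omega n \<Longrightarrow> c \<in> Omega n \<Longrightarrow> entry n (1\<^sub>m (2 * n)) r c = (if r = c then 1 else 0)"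
  by (simp add: entry_def pos_less)

subsection \<open>Transvections\<close>

lemma transvection_carrier [simp]: "transvection n i j x \<in> carrier_mat (2 * n) (2 * n)"
  by (rule carrier_matI) (simp_all add: transvection_def matrix_unit_def)

lemma transvection_mult_carrier [simp]:
  "A \<in> carrier_mat (2 * n) (2 * n) \<Longrightarrow> transvection n i j x * A \<in> carrier_mat (2 * n) (2 * n)"
  by (rule mult_carrier_mat[OF transvection_carrier])

lemma entry_transvection:
  assumes "i \<in> Omega n" "j \<in> Omega n" "r \<in> Omega n" "c \<in> Omega n"
  shows "entry n (transvection n i j x) r c = (if r = c then 1 else 0)
    + (if r = i \<and> c = j then x else 0) - (if r = - j \<and> c = - i then x else 0)"
proof -
  have unit: "entry n (matrix_unit n k l :: 'a mat) r c = (if r = k \<and> c = l then 1 else 0)"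
    if "k \<in> Omega n" "l \<in> Omega n" for k l
    unfolding entry_def matrix_unit_def
    using that assms(3,4) pos_less[OF assms(3)] pos_less[OF assms(4)] by simp
  have "entry n (transvection n i j x) r c = entry n (1\<^sub>m (2 * n)) r c
      + x * entry n (matrix_unit n i j) r c - x * entry n (matrix_unit n (- j) (- i)) r c"
    using pos_less[OF assms(3)] pos_less[OF assms(4)]
    by (simp add: entry_def transvection_def matrix_unit_def)
  also have "\<dots> = (if r = c then 1 else 0)
      + x * (if r = i \<and> c = j then 1 else 0) - x * (if r = - j \<and> c = - i then 1 else 0)"
    using assms by (simp only: unit entry_one Omega_uminus)
  finally show ?thesis by (simp only: if_distrib[of "times x"] mult_1_right mult_zero_right)
qed

lemma entry_transvection_mult:
  assumes "i \<in> Omega n" "j \<in> Omega n" "r \<in> Omega n" "c \<in> Omega n"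
    and "A \<in> carrier_mat (2 * n) (2 * n)"
  shows "entry n (transvection n i j x * A) r c = entry n A r c
    + (if r = i then x * entry n A j c else 0) - (if r = - j then x * entry n A (- i) c else 0)"
proof -
  \<comment> \<open>The tests on \<open>s\<close> stand outermost, so that each of the three sums
    collapses to a single term.\<close>
  have "entry n (transvection n i j x * A) r c =
    (\<Sum>s\<in>Omega n. (if s = r then entry n A s c else 0)
      + (if s = j then if r = i then x * entry n A s c else 0 else 0)
      - (if s = - i then if r = - j then x * entry n A s c else 0 else 0))"
    unfolding entry_mult[OF transvection_carrier assms(5,3,4)]
    using assms(1-3) by (intro sum.cong) (simp_all add: entry_transvection algebra_simps)
  then show ?thesis using assms by (simp add: sum.distrib sum_subtractf)
qed

lemma entry_mult_transvection:
  assumes "i \<in> Omega n" "j \<in> Omega n" "r \<in> Omega n" "c \<in> Omega n"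
    and "A \<in> carrier_mat (2 * n) (2 * n)"
  shows "entry n (A * transvection n i j x) r c = entry n A r c
    + (if c = j then x * entry n A r i else 0) - (if c = - i then x * entry n A r (- j) else 0)"
proof -
  have "entry n (A * transvection n i j x) r c =
    (\<Sum>s\<in>Omega n. (if s = c then entry n A r s else 0)
      + (if s = i then if c = j then x * entry n A r s else 0 else 0)
      - (if s = - j then if c = - i then x * entry n A r s else 0 else 0))"
    unfolding entry_mult[OF assms(5) transvection_carrier assms(3,4)]
    using assms(1-4) by (intro sum.cong) (simp_all add: entry_transvection algebra_simps)
  then show ?thesis using assms by (simp add: sum.distrib sum_subtractf)
qed

lemma transvection_zero [simp]: "transvection n i j 0 = 1\<^sub>m (2 * n)"
  by (auto simp: transvection_def matrix_unit_def)

text \<open>The two off-diagonal terms trade places. Hence every relation can also be read with the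
  indices negated and swapped.\<close>

lemma transvection_uminus: "transvection n i j x = transvection n (- j) (- i) (- x)"
  by (auto simp: transvection_def matrix_unit_def)

lemma transvection_add:
  assumes "i \<in> Omega n" "j \<in> Omega n" "i \<noteq> j" "i \<noteq> - j"
  shows "transvection n i j x * transvection n i j y = transvection n i j (x + y)"
proof -
  note nz = Omega_nonzero[OF assms(1)] Omega_nonzero[OF assms(2)]
  have neq: "- j \<noteq> i" "- i \<noteq> j" "j \<noteq> i" "j \<noteq> - i" using assms by auto
  \<comment> \<open>With a spectator factor \<open>A\<close> on the right all products are nested
    left multiplications, which \<open>entry_transvection_mult\<close> evaluates; \<open>A\<close>
    becomes the identity at the end.\<close>
  have "transvection n i j x * (transvection n i j y * A) = transvection n i j (x + y) * A"
    if A: "A \<in> carrier_mat (2 * n) (2 * n)" for A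
  proof (rule eq_mat_entryI)
    fix r c assume "r \<in> Omega n" "c \<in> Omega n"
    with assms neq nz A show "entry n (transvection n i j x * (transvection n i j y * A)) r c =
        entry n (transvection n i j (x + y) * A) r c"
      by (cases "r = i"; cases "r = - j")
        (simp_all add: entry_transvection_mult ring_distribs)
  qed (use A in simp_all)
  from this[of "1\<^sub>m (2 * n)"] show ?thesis
    by (simp add: right_mult_one_mat[OF transvection_carrier])
qed

text \<open>The Steinberg commutator relation, written without inverses so that it can be checked on
  entries.\<close>

lemma transvection_steinberg:
  assumes "i \<in> Omega n" "j \<in> Omega n" "k \<in> Omega n"
    and "i \<noteq> j" "i \<noteq> - j" "j \<noteq> k" "j \<noteq> - k" "i \<noteq> k" "i \<noteq> - k"
  shows "transvection n i j x * transvection n j k y =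
    transvection n i k (x * y) * (transvection n j k y * transvection n i j x)"
proof -
  note nz = Omega_nonzero[OF assms(1)] Omega_nonzero[OF assms(2)] Omega_nonzero[OF assms(3)]
  have neq: "- j \<noteq> i" "- i \<noteq> j" "j \<noteq> i" "j \<noteq> - i" "- j \<noteq> k" "- k \<noteq> j" "k \<noteq> j" "k \<noteq> - j"
    "- k \<noteq> i" "- i \<noteq> k" "k \<noteq> i" "k \<noteq> - i" using assms by auto
  have "transvection n i j x * (transvection n j k y * A) =
      transvection n i k (x * y) * (transvection n j k y * (transvection n i j x * A))"
    if A: "A \<in> carrier_mat (2 * n) (2 * n)" for A
  proof (rule eq_mat_entryI)
    fix r c assume "r \<in> Omega n" "c \<in> Omega n"
    note rules = assms neq nz A this entry_transvection_mult
    consider "r = i" | "r = j" | "r = - j" | "r = - k"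
      | "r \<noteq> i" "r \<noteq> j" "r \<noteq> - j" "r \<noteq> - k" by blast
    then show "entry n (transvection n i j x * (transvection n j k y * A)) r c =
        entry n (transvection n i k (x * y) * (transvection n j k y * (transvection n i j x * A))) r c"
      by cases (simp_all add: rules, simp_all add: algebra_simps)
  qed (use A in simp_all)
  from this[of "1\<^sub>m (2 * n)"] show ?thesis
    by (simp add: right_mult_one_mat[OF transvection_carrier])
qed

text \<open>By the last four hypotheses the nilpotent parts of the two transvections multiply to
  zero in either order.\<close>

lemma transvection_commute:
  assumes "i \<in> Omega n" "j \<in> Omega n" "k \<in> Omega n" "l \<in> Omega n"
    and "i \<noteq> j" "i \<noteq> - j" "k \<noteq> l" "k \<noteq> - l"
    and "j \<noteq> k" "i \<noteq> l" "i \<noteq> - k" "j \<noteq> - l"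
  shows "transvection n i j x * transvection n k l y =
    transvection n k l y * transvection n i j x"
proof -
  note nz = Omega_nonzero[OF assms(1)] Omega_nonzero[OF assms(2)] Omega_nonzero[OF assms(3)]
    Omega_nonzero[OF assms(4)]
  have neq: "- j \<noteq> i" "- i \<noteq> j" "j \<noteq> i" "j \<noteq> - i" "- k \<noteq> l" "- l \<noteq> k" "l \<noteq> k" "l \<noteq> - k"
    "k \<noteq> j" "l \<noteq> i" "- k \<noteq> i" "- i \<noteq> k" "k \<noteq> - i" "- l \<noteq> j" "- j \<noteq> l" "l \<noteq> - j"
    using assms by auto
  have "transvection n i j x * (transvection n k l y * A) =
      transvection n k l y * (transvection n i j x * A)"
    if A: "A \<in> carrier_mat (2 * n) (2 * n)" for A
  proof (rule eq_mat_entryI)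
    fix r c assume "r \<in> Omega n" "c \<in> Omega n"
    with assms neq nz A show "entry n (transvection n i j x * (transvection n k l y * A)) r c =
        entry n (transvection n k l y * (transvection n i j x * A)) r c"
      by (simp add: entry_transvection_mult)
  qed (use A in simp_all)
  from this[of "1\<^sub>m (2 * n)"] show ?thesis
    by (simp add: right_mult_one_mat[OF transvection_carrier])
qed

text \<open>The nilpotent parts no longer multiply to zero, but by commutativity of the ring both
  orders give the same product, \<open>x * y\<close> at position \<open>(i, - i)\<close>.\<close>

lemma transvection_commute_opposite:
  assumes "i \<in> Omega n" "j \<in> Omega n" "i \<noteq> j" "i \<noteq> - j"
  shows "transvection n i j x * transvection n j (- i) y =
    transvection n j (- i) y * transvection n i j x"
proof -
  note nz = Omega_nonzero[OF assms(1)] Omega_nonzero[OF assms(2)]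
  have neq: "- j \<noteq> i" "- i \<noteq> j" "j \<noteq> i" "j \<noteq> - i" using assms by auto
  have "transvection n i j x * (transvection n j (- i) y * A) =
      transvection n j (- i) y * (transvection n i j x * A)"
    if A: "A \<in> carrier_mat (2 * n) (2 * n)" for A
  proof (rule eq_mat_entryI)
    fix r c assume "r \<in> Omega n" "c \<in> Omega n"
    note rules = assms neq nz A this entry_transvection_mult
    show "entry n (transvection n i j x * (transvection n j (- i) y * A)) r c =
        entry n (transvection n j (- i) y * (transvection n i j x * A)) r c"
      by (cases "r = i"; cases "r = j"; cases "r = - j")
        (simp_all add: rules, simp_all add: algebra_simps)
  qed (use A in simp_all)
  from this[of "1\<^sub>m (2 * n)"] show ?thesis
    by (simp add: right_mult_one_mat[OF transvection_carrier])
qed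

subsection \<open>The orthogonal group\<close>

definition coord :: "nat \<Rightarrow> 'a vec \<Rightarrow> int \<Rightarrow> 'a" where
  "coord n v i = v $ pos n i"

lemma coord_mult_mat_vec:
  assumes "A \<in> carrier_mat (2 * n) (2 * n)" "v \<in> carrier_vec (2 * n)" "r \<in> Omega n"
  shows "coord n (A *\<^sub>v v) r = (\<Sum>s\<in>Omega n. entry n A r s * coord n v s)"
  using assms pos_less[OF assms(3)]
  by (auto simp: coord_def entry_def scalar_prod_def sum_Omega pos_less intro!: sum.cong)

lemma coord_transvection:
  fixes v :: "'a::comm_ring_1 vec"
  assumes "i \<in> Omega n" "j \<in> Omega n" "r \<in> Omega n" "v \<in> carrier_vec (2 * n)"
  shows "coord n (transvection n i j x *\<^sub>v v) r = coord n v r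
    + (if r = i then x * coord n v j else 0) - (if r = - j then x * coord n v (- i) else 0)"
proof -
  have "coord n (transvection n i j x *\<^sub>v v) r =
    (\<Sum>s\<in>Omega n. (if s = r then coord n v s else 0)
      + (if s = j then if r = i then x * coord n v s else 0 else 0)
      - (if s = - i then if r = - j then x * coord n v s else 0 else 0))"
    unfolding coord_mult_mat_vec[OF transvection_carrier assms(4,3)]
    using assms(1-3) by (intro sum.cong) (simp_all add: entry_transvection algebra_simps)
  then show ?thesis using assms by (simp add: sum.distrib sum_subtractf)
qed

text \<open>For \<open>i > 0\<close>, row \<open>i - 1\<close> of the upper right block has its 1 in
  column \<open>n - i\<close> of that block. This is column \<open>2 * n - i\<close> of the whole
  matrix, the position of \<open>- i\<close>.\<close>

lemma quad_form_coord:
  fixes v :: "'a::comm_ring_1 vec"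
  assumes v: "v \<in> carrier_vec (2 * n)"
  shows "quad_form n v = (\<Sum>i\<in>{1..int n}. coord n v i * coord n v (- i))"
proof -
  let ?M = "four_block_mat (0\<^sub>m n n) (skew_diag n) (0\<^sub>m n n) (0\<^sub>m n n) :: 'a mat"
  have M: "?M \<in> carrier_mat (2 * n) (2 * n)"
    unfolding mult_2 by (rule four_block_carrier_mat) (simp_all add: skew_diag_def)
  have M_entry: "entry n ?M i j = (if i > 0 \<and> j = - i then 1 else 0)"
    if "i \<in> Omega n" "j \<in> Omega n" for i j
  proof -
    have "pos n k < n \<longleftrightarrow> k > 0" if "k \<in> Omega n" for k
      using that by (auto simp: pos_def Omega_def)
    moreover have "pos n i + (pos n j - n) = n - 1 \<longleftrightarrow> j = - i" if "i > 0" "\<not> j > 0"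
      using that \<open>i \<in> Omega n\<close> \<open>j \<in> Omega n\<close> by (auto simp: pos_def Omega_def)
    moreover have "pos n j - n < n" using pos_less[OF that(2)] by linarith
    moreover have "j \<noteq> - i" if "i > 0" "j > 0" using that by simp
    ultimately show ?thesis
      using that pos_less[OF that(1)] pos_less[OF that(2)]
      by (cases "i > 0"; cases "j > 0") (simp_all add: entry_def skew_diag_def)
  qed
  have "quad_form n v = (\<Sum>i\<in>Omega n. coord n v i * coord n (?M *\<^sub>v v) i)"
  proof -
    have "dim_vec (?M *\<^sub>v v) = 2 * n" using M by auto
    then show ?thesis
      unfolding quad_form_def scalar_prod_def coord_def by (simp only: sum_Omega)
  qed
  also have "\<dots> = (\<Sum>i\<in>Omega n. if i > 0 then coord n v i * coord n v (- i) else 0)"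
  proof (rule sum.cong[OF refl])
    fix i assume i: "i \<in> Omega n"
    have "coord n (?M *\<^sub>v v) i = (\<Sum>s\<in>Omega n. if s = - i then if i > 0 then coord n v s else 0 else 0)"
      unfolding coord_mult_mat_vec[OF M v i] using i by (intro sum.cong) (auto simp: M_entry)
    then show "coord n v i * coord n (?M *\<^sub>v v) i =
        (if i > 0 then coord n v i * coord n v (- i) else 0)"
      using i by simp
  qed
  also have "\<dots> = (\<Sum>i\<in>{1..int n}. coord n v i * coord n v (- i))"
    unfolding sum_Omega_split by (intro sum.cong) auto
  finally show ?thesis .
qed

text \<open>Only the hyperbolic pairs of \<open>i\<close> and \<open>j\<close> are affected: the
  product of the first gains \<open>?c\<close> and that of the second loses it. The absolute values
  name the positive member of each pair.\<close>

lemma quad_form_transvection: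
  fixes v :: "'a::comm_ring_1 vec"
  assumes "i \<in> Omega n" "j \<in> Omega n" "i \<noteq> j" "i \<noteq> - j" and v: "v \<in> carrier_vec (2 * n)"
  shows "quad_form n (transvection n i j x *\<^sub>v v) = quad_form n v"
proof -
  let ?w = "transvection n i j x *\<^sub>v v"
  let ?c = "x * coord n v j * coord n v (- i)"
  have w: "?w \<in> carrier_vec (2 * n)" using v by (metis mult_mat_vec_carrier transvection_carrier)
  have "coord n ?w r * coord n ?w (- r) = coord n v r * coord n v (- r)
      + (if r = \<bar>i\<bar> then ?c else 0) - (if r = \<bar>j\<bar> then ?c else 0)"
    if "r \<in> {1..int n}" for r
  proof -
    have r: "r \<in> Omega n" "- r \<in> Omega n" "r > 0" using that by (auto simp: Omega_def)
    show ?thesis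
      using assms r by (cases "i > 0"; cases "j > 0")
        (auto simp: coord_transvection[OF assms(1,2) _ v] algebra_simps)
  qed
  then have "quad_form n ?w = (\<Sum>r\<in>{1..int n}. coord n v r * coord n v (- r)
      + (if r = \<bar>i\<bar> then ?c else 0) - (if r = \<bar>j\<bar> then ?c else 0))"
    by (simp add: quad_form_coord[OF w])
  then show ?thesis using assms
    by (simp add: sum.distrib sum_subtractf quad_form_coord[OF v]) (auto simp: Omega_def)
qed

section \<open>Transvections as elements of the orthogonal group\<close>

lemma GL_group_iff:
  fixes A :: "'a::comm_ring_1 mat"
  shows "A \<in> carrier (GL_group m) \<longleftrightarrow>
    A \<in> carrier_mat m m \<and> (\<exists>B \<in> carrier_mat m m. B * A = 1\<^sub>m m \<and> A * B = 1\<^sub>m m)"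
  by (auto simp: GL_group_def units_of_def Units_def ring_mat_simps)

lemma transvection_O_group:
  assumes "i \<in> Omega n" "j \<in> Omega n" "i \<noteq> j" "i \<noteq> - j"
  shows "transvection n i j x \<in> carrier (O_group n)"
proof -
  have "transvection n i j x \<in> carrier (GL_group (2 * n))"
    unfolding GL_group_iff using assms
    by (auto simp: transvection_add intro!: bexI[of _ "transvection n i j (- x)"])
  then show ?thesis using assms by (simp add: O_group_def quad_form_transvection)
qed

lemma O_group_simps:
  "A \<otimes>\<^bsub>O_group n\<^esub> B = A * B" "\<one>\<^bsub>O_group n\<^esub> = 1\<^sub>m (2 * n)"
  by (simp_all add: O_group_def GL_group_simps)

lemma O_group_carrier_mat: "A \<in> carrier (O_group n) \<Longrightarrow> A \<in> carrier_mat (2 * n) (2 * n)"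
  by (auto simp: O_group_def intro: GL_group_carrierD)

lemma inv_transvection:
  fixes x :: "'a::comm_ring_1"
  assumes "i \<in> Omega n" "j \<in> Omega n" "i \<noteq> j" "i \<noteq> - j"
  shows "inv\<^bsub>O_group n\<^esub> (transvection n i j x) = transvection n i j (- x)"
  by (rule group.inv_equality[OF O_group_group])
    (use assms in \<open>auto simp: transvection_O_group transvection_add O_group_simps\<close>)

text \<open>Polarizing the quadratic form shows that the columns of an orthogonal matrix form a
  hyperbolic basis.\<close>

lemma O_group_columns:
  fixes A :: "'a::comm_ring_1 mat"
  assumes A: "A \<in> carrier (O_group n)" and ij: "i \<in> Omega n" "j \<in> Omega n"
  shows "(\<Sum>r\<in>Omega n. entry n A r i * entry n A (- r) j) = (if i = - j then 1 else 0)"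
proof -
  have polar: "quad_form n (u + v) - quad_form n u - quad_form n v =
      (\<Sum>r\<in>Omega n. coord n u r * coord n v (- r))"
    if "u \<in> carrier_vec (2 * n)" "v \<in> carrier_vec (2 * n)" for u v :: "'a vec"
  proof -
    have "coord n (u + v) r = coord n u r + coord n v r" if "r \<in> Omega n" for r
      using that \<open>u \<in> _\<close> \<open>v \<in> _\<close> pos_less[of r n] by (simp add: coord_def)
    moreover have "r \<in> Omega n" if "r \<in> {1..int n}" for r using that by (auto simp: Omega_def)
    ultimately show ?thesis using that unfolding sum_Omega_split
      by (simp add: quad_form_coord sum_subtractf[symmetric] algebra_simps)
  qed
  note cA = O_group_carrier_mat[OF A]
  let ?e = "\<lambda>k. unit_vec (2 * n) (pos n k) :: 'a vec"
  have e: "?e k \<in> carrier_vec (2 * n)" for k by simp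
  have coord_e: "coord n (?e k) r = (if r = k then 1 else 0)"
    if "k \<in> Omega n" "r \<in> Omega n" for k r
    using that by (auto simp: coord_def pos_less unit_vec_def)
  have coord_Ae: "coord n (A *\<^sub>v ?e k) r = entry n A r k" if k: "k \<in> Omega n" "r \<in> Omega n" for k r
  proof -
    have "coord n (A *\<^sub>v ?e k) r = (\<Sum>s\<in>Omega n. if s = k then entry n A r s else 0)"
      unfolding coord_mult_mat_vec[OF cA e k(2)] using k by (intro sum.cong) (auto simp: coord_e)
    then show ?thesis using k by simp
  qed
  have inv: "quad_form n (A *\<^sub>v v) = quad_form n v" if "v \<in> carrier_vec (2 * n)" for v
    using A that by (auto simp: O_group_def)
  have "(\<Sum>r\<in>Omega n. entry n A r i * entry n A (- r) j) =
      (\<Sum>r\<in>Omega n. coord n (A *\<^sub>v ?e i) r * coord n (A *\<^sub>v ?e j) (- r))"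
    using ij by (intro sum.cong) (auto simp: coord_Ae)
  also have "\<dots> = quad_form n (A *\<^sub>v ?e i + A *\<^sub>v ?e j)
      - quad_form n (A *\<^sub>v ?e i) - quad_form n (A *\<^sub>v ?e j)"
    using cA by (intro polar[symmetric]) auto
  also have "A *\<^sub>v ?e i + A *\<^sub>v ?e j = A *\<^sub>v (?e i + ?e j)"
    by (rule mult_add_distrib_mat_vec[OF cA e e, symmetric])
  also have "quad_form n (A *\<^sub>v (?e i + ?e j)) - quad_form n (A *\<^sub>v ?e i) - quad_form n (A *\<^sub>v ?e j)
      = (\<Sum>r\<in>Omega n. coord n (?e i) r * coord n (?e j) (- r))"
    by (simp add: inv polar)
  also have "\<dots> = (\<Sum>r\<in>Omega n. if r = i then if i = - j then 1 else 0 else 0)"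
    using ij by (intro sum.cong) (auto simp: coord_e)
  finally show ?thesis using ij by simp
qed

text \<open>The hyperbolic relations between the columns say that the reflection of \<open>A\<close>
  in the skew diagonal is a left inverse of \<open>A\<close>, and a left inverse of an invertible
  matrix is the inverse.\<close>

lemma entry_inv_O_group:
  fixes A :: "'a::comm_ring_1 mat"
  assumes A: "A \<in> carrier (O_group n)" and rc: "r \<in> Omega n" "c \<in> Omega n"
  shows "entry n (inv\<^bsub>O_group n\<^esub> A) r c = entry n A (- c) (- r)"
proof -
  interpret group "O_group n :: 'a mat monoid" by (rule O_group_group)
  \<comment> \<open>Matrices are built from positions, so the reflection needs the way back from
    positions to indices.\<close>
  define idx where "idx = the_inv_into (Omega n) (pos n)"
  have idx: "idx (pos n k) = k" if "k \<in> Omega n" for k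
    unfolding idx_def by (rule the_inv_into_f_f) (auto simp: that inj_on_def)
  define S where "S = mat (2 * n) (2 * n) (\<lambda>(p, q). entry n A (- idx q) (- idx p))"
  have cS: "S \<in> carrier_mat (2 * n) (2 * n)" by (simp add: S_def)
  have S: "entry n S k l = entry n A (- l) (- k)" if "k \<in> Omega n" "l \<in> Omega n" for k l
    using that by (simp add: S_def entry_def idx pos_less)
  note cA = O_group_carrier_mat[OF A] and cI = O_group_carrier_mat[OF inv_closed[OF A]]
  have "S * A = 1\<^sub>m (2 * n)"
  proof (rule eq_mat_entryI)
    fix k l assume kl: "k \<in> Omega n" "l \<in> Omega n"
    have "entry n (S * A) k l = (\<Sum>s\<in>Omega n. entry n A (- s) (- k) * entry n A s l)"
      using kl by (auto simp: entry_mult[OF cS cA] S intro!: sum.cong)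
    also have "\<dots> = (\<Sum>s\<in>Omega n. entry n A s l * entry n A (- s) (- k))"
      by (simp add: mult.commute)
    also have "\<dots> = entry n (1\<^sub>m (2 * n)) k l"
      using kl by (simp add: O_group_columns[OF A])
    finally show "entry n (S * A) k l = entry n (1\<^sub>m (2 * n)) k l" .
  qed (use cS cA in auto)
  moreover have "A * inv\<^bsub>O_group n\<^esub> A = 1\<^sub>m (2 * n)" using r_inv[OF A] by (simp add: O_group_simps)
  ultimately have "S = inv\<^bsub>O_group n\<^esub> A"
    using assoc_mult_mat[OF cS cA cI] cS cI by simp
  then show ?thesis using S[OF rc] by simp
qed

text \<open>Conjugating by an element that fixes \<open>e\<^sub>a\<close> preserves the unipotent radical of the
  stabilizer of \<open>e\<^sub>a\<close>, which is abelian.\<close>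

lemma conj_transvection_commute:
  fixes \<rho> :: "'a::comm_ring_1 mat" and x y :: 'a
  assumes \<rho>: "\<rho> \<in> carrier (O_group n)"
    and ind: "a \<in> Omega n" "m \<in> Omega n" "l \<in> Omega n"
    and neq: "m \<noteq> a" "m \<noteq> - a" "l \<noteq> a" "l \<noteq> - a"
    and fixes_a: "\<And>r. r \<in> Omega n \<Longrightarrow> entry n \<rho> r a = (if r = a then 1 else 0)"
  defines "X \<equiv> inv\<^bsub>O_group n\<^esub> \<rho> * (transvection n a m x * \<rho>)"
  shows "X * transvection n a l y = transvection n a l y * X"
proof -
  interpret group "O_group n :: 'a mat monoid" by (rule O_group_group)
  let ?J = "inv\<^bsub>O_group n\<^esub> \<rho>"
  note c\<rho> = O_group_carrier_mat[OF \<rho>] and cJ = O_group_carrier_mat[OF inv_closed[OF \<rho>]]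
  have J\<rho>: "?J * \<rho> = 1\<^sub>m (2 * n)" using l_inv[OF \<rho>] by (simp add: O_group_simps)
  have cX: "X \<in> carrier_mat (2 * n) (2 * n)"
    unfolding X_def by (rule mult_carrier_mat[OF cJ]) (simp add: c\<rho>)
  have J_entry: "entry n ?J r c = entry n \<rho> (- c) (- r)" if "r \<in> Omega n" "c \<in> Omega n" for r c
    using that by (rule entry_inv_O_group[OF \<rho>])
  \<comment> \<open>The inverse fixes \<open>e_a\<close> as well; through \<open>J_entry\<close>
    this determines row \<open>- a\<close> of \<open>\<rho>\<close>.\<close>
  have J_col: "entry n ?J r a = (if r = a then 1 else 0)" if r: "r \<in> Omega n" for r
  proof -
    have "(if r = a then 1 else 0) = (\<Sum>s\<in>Omega n. entry n ?J r s * entry n \<rho> s a)"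
      using entry_mult[OF cJ c\<rho> r ind(1)] r ind unfolding J\<rho> by simp
    also have "\<dots> = (\<Sum>s\<in>Omega n. if s = a then entry n ?J r s else 0)"
      by (intro sum.cong) (simp_all add: fixes_a)
    finally show ?thesis using ind by simp
  qed
  have \<rho>_row: "entry n \<rho> (- a) c = (if c = - a then 1 else 0)" if c: "c \<in> Omega n" for c
    using J_col[of "- c"] J_entry[of "- c" a] c ind by auto
  \<comment> \<open>So \<open>X\<close> differs from the identity only in row \<open>a\<close> and
    column \<open>- a\<close>, as an element of the unipotent radical should.\<close>
  have X_entry: "entry n X r c = (if r = c then 1 else 0)
      + (if r = a then x * entry n \<rho> m c else 0)
      - (if c = - a then x * entry n \<rho> m (- r) else 0)"
    if rc: "r \<in> Omega n" "c \<in> Omega n" for r c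
  proof -
    have "entry n X r c = (\<Sum>s\<in>Omega n. entry n ?J r s * entry n \<rho> s c
      + (if s = a then entry n ?J r s * (x * entry n \<rho> m c) else 0)
      - (if s = - m then entry n ?J r s * (x * entry n \<rho> (- a) c) else 0))"
      unfolding X_def entry_mult[OF cJ transvection_mult_carrier[OF c\<rho>] rc]
      using rc ind by (intro sum.cong) (simp_all add: entry_transvection_mult[OF ind(1,2) _ rc(2) c\<rho>] algebra_simps)
    also have "\<dots> = (\<Sum>s\<in>Omega n. entry n ?J r s * entry n \<rho> s c)
      + entry n ?J r a * (x * entry n \<rho> m c) - entry n ?J r (- m) * (x * entry n \<rho> (- a) c)"
      using ind by (simp add: sum.distrib sum_subtractf)
    also have "(\<Sum>s\<in>Omega n. entry n ?J r s * entry n \<rho> s c) = (if r = c then 1 else 0)"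
      using entry_mult[OF cJ c\<rho> rc] rc unfolding J\<rho> by simp
    finally show ?thesis using rc ind by (simp add: J_col \<rho>_row J_entry)
  qed
  show ?thesis
  proof (rule eq_mat_entryI)
    fix r c assume rc: "r \<in> Omega n" "c \<in> Omega n"
    have neq': "- l \<noteq> a" "- a \<noteq> l" "a \<noteq> l" "a \<noteq> - l" "- a \<noteq> a" using neq ind by auto
    have "entry n \<rho> m a = 0" using neq ind by (simp add: fixes_a)
    then have *: "entry n X l c = (if l = c then 1 else 0) - (if c = - a then x * entry n \<rho> m (- l) else 0)"
      "entry n X (- a) c = (if - a = c then 1 else 0)"
      "entry n X r a = (if r = a then 1 else 0)"
      "entry n X r (- l) = (if r = - l then 1 else 0) + (if r = a then x * entry n \<rho> m (- l) else 0)"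
      using rc ind neq neq' by (simp_all add: X_entry)
    show "entry n (X * transvection n a l y) r c = entry n (transvection n a l y * X) r c"
      unfolding entry_mult_transvection[OF ind(1,3) rc cX] entry_transvection_mult[OF ind(1,3) rc cX] *
      using neq neq' ind by (auto simp: algebra_simps)
  qed (use cX mult_carrier_mat[OF cX transvection_carrier] in simp_all)
qed

subsection \<open>Products of conjugates\<close>

context group
begin

lemma conj_by_closed [simp]: "g \<in> carrier G \<Longrightarrow> h \<in> carrier G \<Longrightarrow> conj_by G g h \<in> carrier G"
  by (simp add: conj_by_def)

lemma mult_inv_cancel [simp]:
  assumes "x \<in> carrier G" "y \<in> carrier G"
  shows "x \<otimes> (inv x \<otimes> y) = y" "inv x \<otimes> (x \<otimes> y) = y"
  using assms by (simp_all add: m_assoc[symmetric])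

lemma conj_by_mult:
  "g \<in> carrier G \<Longrightarrow> x \<in> carrier G \<Longrightarrow> y \<in> carrier G \<Longrightarrow>
    conj_by G g (x \<otimes> y) = conj_by G g x \<otimes> conj_by G g y"
  by (simp add: conj_by_def m_assoc)

lemma conj_by_inv:
  "g \<in> carrier G \<Longrightarrow> x \<in> carrier G \<Longrightarrow> inv (conj_by G g x) = conj_by G g (inv x)"
  by (simp add: conj_by_def m_assoc inv_mult_group)

lemma conj_by_conj_by:
  "g \<in> carrier G \<Longrightarrow> h \<in> carrier G \<Longrightarrow> x \<in> carrier G \<Longrightarrow>
    conj_by G g (conj_by G h x) = conj_by G (g \<otimes> h) x"
  by (simp add: conj_by_def m_assoc inv_mult_group)

lemma conj_by_one [simp]: "x \<in> carrier G \<Longrightarrow> conj_by G \<one> x = x"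
  by (simp add: conj_by_def)

lemma conj_by_eqI:
  assumes "g \<in> carrier G" "x \<in> carrier G" "y \<in> carrier G" "g \<otimes> x = y \<otimes> g"
  shows "conj_by G g x = y"
  using assms by (simp add: conj_by_def m_assoc)

text \<open>Up to conjugation the commutator of \<open>t\<close> and \<open>s t s\<^sup>-\<^sup>1\<close> with \<open>e\<close> splits into \<open>b\<close>, which
  commutes with \<open>c\<close> and \<open>f\<close>, and a factor whose commutator with \<open>c\<close> is \<open>f\<close>.\<close>

lemma iterated_commutator:
  fixes s t e c d f
  defines "r \<equiv> s \<otimes> t \<otimes> inv s"
  defines "b \<equiv> inv r \<otimes> (e \<otimes> r)"
  defines "x \<equiv> conj_by G t s \<otimes> inv s"
  defines "y \<equiv> conj_by G (inv t) (x \<otimes> conj_by G e (inv x))"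
  assumes [simp]: "s \<in> carrier G" "t \<in> carrier G" "e \<in> carrier G" "c \<in> carrier G"
      "d \<in> carrier G" "f \<in> carrier G"
    and et: "inv e \<otimes> t = t \<otimes> (d \<otimes> inv e)"
    and dc: "d \<otimes> c = f \<otimes> (c \<otimes> d)"
    and ce: "c \<otimes> e = e \<otimes> c"
    and bc: "b \<otimes> c = c \<otimes> b"
    and bf: "b \<otimes> f = f \<otimes> b"
  shows "y \<otimes> conj_by G c (inv y) = f"
proof -
  have [simp]: "r \<in> carrier G" "b \<in> carrier G" "x \<in> carrier G" "y \<in> carrier G"
    by (simp_all add: r_def b_def x_def y_def)
  have x: "x = t \<otimes> inv r" by (simp add: x_def r_def conj_by_def m_assoc inv_mult_group)
  \<comment> \<open>The conjugation by \<open>inv t\<close> in \<open>y\<close> cancels the leading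
    \<open>t\<close> of \<open>x\<close>. What remains is \<open>b\<close>, a conjugate of
    \<open>e\<close>, followed by a conjugate of \<open>inv e\<close>.\<close>
  have "y = b \<otimes> (inv t \<otimes> (inv e \<otimes> t))"
    by (simp add: y_def x b_def conj_by_def m_assoc inv_mult_group)
  then have y: "y = b \<otimes> (d \<otimes> inv e)" by (simp add: et)
  have "c \<otimes> inv e = inv e \<otimes> c"
  proof -
    have "c \<otimes> inv e = inv e \<otimes> (e \<otimes> c) \<otimes> inv e" by simp
    also have "\<dots> = inv e \<otimes> c" by (simp add: ce[symmetric] m_assoc)
    finally show ?thesis .
  qed
  \<comment> \<open>As \<open>c\<close> moves to the left through \<open>y\<close>, only the passage
    across \<open>d\<close> leaves a trace, namely \<open>f\<close>.\<close>
  then have "y \<otimes> c = b \<otimes> (d \<otimes> c \<otimes> inv e)" by (simp add: y m_assoc)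
  also have "\<dots> = b \<otimes> f \<otimes> (c \<otimes> (d \<otimes> inv e))" by (simp add: dc m_assoc)
  also have "\<dots> = f \<otimes> (b \<otimes> c \<otimes> (d \<otimes> inv e))" by (simp add: bf m_assoc)
  also have "\<dots> = f \<otimes> (c \<otimes> y)" by (simp add: bc y m_assoc)
  finally have yc: "y \<otimes> c = f \<otimes> (c \<otimes> y)" .
  have "y \<otimes> conj_by G c (inv y) = (y \<otimes> c) \<otimes> (inv y \<otimes> inv c)"
    by (simp add: conj_by_def m_assoc)
  also have "\<dots> = f" by (simp add: yc m_assoc)
  finally show ?thesis .
qed

end

text \<open>The Steinberg relation solved for the conjugate; the inverse of the commutator accounts
  for the minus sign.\<close>

lemma conj_by_transvection:
  fixes x y :: "'a::comm_ring_1"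
  assumes "i \<in> Omega n" "j \<in> Omega n" "k \<in> Omega n"
    and "i \<noteq> j" "i \<noteq> - j" "j \<noteq> k" "j \<noteq> - k" "i \<noteq> k" "i \<noteq> - k"
  shows "conj_by (O_group n) (transvection n j k y) (transvection n i j x) =
    transvection n i k (- (x * y)) \<otimes>\<^bsub>O_group n\<^esub> transvection n i j x"
proof -
  interpret group "O_group n :: 'a mat monoid" by (rule O_group_group)
  let ?A = "transvection n i j x" and ?B = "transvection n j k y" and ?C = "transvection n i k (x * y)"
  have mats: "?A \<in> carrier (O_group n)" "?B \<in> carrier (O_group n)" "?C \<in> carrier (O_group n)"
    using assms by (auto intro!: transvection_O_group)
  have C: "transvection n i k (- (x * y)) = inv\<^bsub>O_group n\<^esub> ?C"
    using assms by (intro inv_transvection[symmetric])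
  have "?A \<otimes>\<^bsub>O_group n\<^esub> ?B = ?C \<otimes>\<^bsub>O_group n\<^esub> (?B \<otimes>\<^bsub>O_group n\<^esub> ?A)"
    unfolding O_group_simps using assms by (intro transvection_steinberg)
  then have "inv\<^bsub>O_group n\<^esub> ?C \<otimes>\<^bsub>O_group n\<^esub> (?A \<otimes>\<^bsub>O_group n\<^esub> ?B) = ?B \<otimes>\<^bsub>O_group n\<^esub> ?A"
    using mats by simp
  then show ?thesis
    unfolding C using mats by (intro conj_by_eqI) (simp_all add: m_assoc)
qed

section \<open>The elementary subgroup and its action on conjugates\<close>

lemma EO_subgroup: "subgroup (EO n) (O_group n :: 'a::comm_ring_1 mat monoid)"
  unfolding EO_def
  by (rule group.generate_is_subgroup[OF O_group_group]) (auto simp: transvection_O_group)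

lemmas EO_closed =
  subgroup.m_closed[OF EO_subgroup] subgroup.m_inv_closed[OF EO_subgroup]
  subgroup.one_closed[OF EO_subgroup]
lemmas EO_carrier = subgroup.mem_carrier[OF EO_subgroup]

lemma transvection_EO:
  "i \<in> Omega n \<Longrightarrow> j \<in> Omega n \<Longrightarrow> i \<noteq> j \<Longrightarrow> i \<noteq> - j \<Longrightarrow> transvection n i j x \<in> EO n"
  unfolding EO_def by (rule generate.incl) blast

lemma elem_conjugates_carrier:
  fixes \<sigma> :: "'a::comm_ring_1 mat"
  assumes "\<sigma> \<in> carrier (O_group n)"
  shows "elem_conjugates n \<sigma> \<subseteq> carrier (O_group n)"
proof -
  interpret group "O_group n :: 'a mat monoid" by (rule O_group_group)
  show ?thesis using assms by (auto simp: elem_conjugates_def EO_carrier)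
qed

lemma elem_conjugates_conj_by:
  fixes \<sigma> :: "'a::comm_ring_1 mat"
  assumes "\<sigma> \<in> carrier (O_group n)" "\<epsilon> \<in> EO n" "g \<in> elem_conjugates n \<sigma>"
  shows "conj_by (O_group n) \<epsilon> g \<in> elem_conjugates n \<sigma>"
proof -
  interpret group "O_group n :: 'a mat monoid" by (rule O_group_group)
  show ?thesis using assms
    by (auto simp: elem_conjugates_def EO_carrier conj_by_conj_by intro: EO_closed)
qed

lemma elem_conjugates_inv:
  fixes \<sigma> :: "'a::comm_ring_1 mat"
  assumes "\<sigma> \<in> carrier (O_group n)" "g \<in> elem_conjugates n \<sigma>"
  shows "inv\<^bsub>O_group n\<^esub> g \<in> elem_conjugates n \<sigma>"
proof -
  interpret group "O_group n :: 'a mat monoid" by (rule O_group_group)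
  show ?thesis using assms by (auto simp: elem_conjugates_def EO_carrier conj_by_inv)
qed

text \<open>Allows entries of an elementary conjugate of \<open>\<sigma>\<close> to be used in place
  of entries of \<open>\<sigma>\<close>, with the same number of factors.\<close>

lemma elem_conjugates_of_conj_by:
  fixes \<sigma> :: "'a::comm_ring_1 mat"
  assumes "\<sigma> \<in> carrier (O_group n)" "\<epsilon> \<in> EO n"
  shows "elem_conjugates n (conj_by (O_group n) \<epsilon> \<sigma>) \<subseteq> elem_conjugates n \<sigma>"
proof -
  interpret group "O_group n :: 'a mat monoid" by (rule O_group_group)
  show ?thesis using assms
    by (auto simp: elem_conjugates_def EO_carrier conj_by_conj_by conj_by_inv intro: EO_closed)
qed

section \<open>Counting factors\<close>

lemma is_product_mono:
  "is_product_of_elem_conjugates n m \<sigma> A \<Longrightarrow> elem_conjugates n \<sigma> \<subseteq> elem_conjugates n \<tau> \<Longrightarrow>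
    is_product_of_elem_conjugates n m \<tau> A"
  unfolding is_product_of_elem_conjugates_def by blast

lemma is_product_0:
  "is_product_of_elem_conjugates n 0 \<sigma> A \<longleftrightarrow> A = \<one>\<^bsub>O_group n\<^esub>"
  by (auto simp: is_product_of_elem_conjugates_def)

text \<open>Together with \<open>is_product_0\<close> this recursion replaces lists of factors by
  induction on their number.\<close>

lemma is_product_Suc:
  "is_product_of_elem_conjugates n (Suc m) \<sigma> A \<longleftrightarrow>
    (\<exists>g B. g \<in> elem_conjugates n \<sigma> \<and> is_product_of_elem_conjugates n m \<sigma> B \<and>
      A = g \<otimes>\<^bsub>O_group n\<^esub> B)"
proof
  assume "is_product_of_elem_conjugates n (Suc m) \<sigma> A"
  then obtain gs where "length gs = Suc m" "set gs \<subseteq> elem_conjugates n \<sigma>"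
    "A = foldr (\<otimes>\<^bsub>O_group n\<^esub>) gs \<one>\<^bsub>O_group n\<^esub>"
    unfolding is_product_of_elem_conjugates_def by blast
  then show "\<exists>g B. g \<in> elem_conjugates n \<sigma> \<and> is_product_of_elem_conjugates n m \<sigma> B \<and>
      A = g \<otimes>\<^bsub>O_group n\<^esub> B"
    unfolding is_product_of_elem_conjugates_def by (cases gs) auto
next
  assume "\<exists>g B. g \<in> elem_conjugates n \<sigma> \<and> is_product_of_elem_conjugates n m \<sigma> B \<and>
      A = g \<otimes>\<^bsub>O_group n\<^esub> B"
  then obtain g gs where "g \<in> elem_conjugates n \<sigma>" "length gs = m" "set gs \<subseteq> elem_conjugates n \<sigma>"
    "A = g \<otimes>\<^bsub>O_group n\<^esub> foldr (\<otimes>\<^bsub>O_group n\<^esub>) gs \<one>\<^bsub>O_group n\<^esub>"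
    unfolding is_product_of_elem_conjugates_def by blast
  then show "is_product_of_elem_conjugates n (Suc m) \<sigma> A"
    unfolding is_product_of_elem_conjugates_def by (intro exI[of _ "g # gs"]) auto
qed

context
  fixes n :: nat and \<sigma> :: "'a::comm_ring_1 mat"
  assumes \<sigma>: "\<sigma> \<in> carrier (O_group n)"
begin

interpretation group "O_group n :: 'a mat monoid" by (rule O_group_group)

lemmas elem_conj_carrier = subsetD[OF elem_conjugates_carrier[OF \<sigma>]]

lemma is_product_carrier:
  "is_product_of_elem_conjugates n m \<sigma> A \<Longrightarrow> A \<in> carrier (O_group n)"
  by (induction m arbitrary: A) (auto simp: is_product_0 is_product_Suc elem_conj_carrier)

lemma is_product_mult:
  assumes "is_product_of_elem_conjugates n m \<sigma> A" "is_product_of_elem_conjugates n k \<sigma> B"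
  shows "is_product_of_elem_conjugates n (m + k) \<sigma> (A \<otimes>\<^bsub>O_group n\<^esub> B)"
  using assms(1)
proof (induction m arbitrary: A)
  case 0
  then show ?case using assms(2) by (simp add: is_product_0 is_product_carrier)
next
  case (Suc m)
  then obtain g C where "g \<in> elem_conjugates n \<sigma>" "is_product_of_elem_conjugates n m \<sigma> C"
    "A = g \<otimes>\<^bsub>O_group n\<^esub> C" by (auto simp: is_product_Suc)
  with Suc.IH[of C] show ?case
    using is_product_carrier[OF assms(2)]
    by (auto simp: is_product_Suc is_product_carrier elem_conj_carrier m_assoc)
qed

lemma is_product_single:
  "g \<in> elem_conjugates n \<sigma> \<Longrightarrow> is_product_of_elem_conjugates n 1 \<sigma> g"
  by (simp add: is_product_Suc is_product_0) (metis elem_conj_carrier r_one)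

lemma is_product_inv:
  "is_product_of_elem_conjugates n m \<sigma> A \<Longrightarrow>
    is_product_of_elem_conjugates n m \<sigma> (inv\<^bsub>O_group n\<^esub> A)"
proof (induction m arbitrary: A)
  case (Suc m)
  then obtain g C where g: "g \<in> elem_conjugates n \<sigma>" "is_product_of_elem_conjugates n m \<sigma> C"
    "A = g \<otimes>\<^bsub>O_group n\<^esub> C" by (auto simp: is_product_Suc)
  show ?case
    using is_product_mult[OF Suc.IH[OF g(2)] is_product_single[OF elem_conjugates_inv[OF \<sigma> g(1)]]] g
    by (simp add: inv_mult_group elem_conj_carrier is_product_carrier)
qed (simp add: is_product_0)

lemma is_product_conj_by:
  assumes \<epsilon>: "\<epsilon> \<in> EO n"
  shows "is_product_of_elem_conjugates n m \<sigma> A \<Longrightarrow>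
    is_product_of_elem_conjugates n m \<sigma> (conj_by (O_group n) \<epsilon> A)"
proof (induction m arbitrary: A)
  case 0
  then show ?case using \<epsilon> by (simp add: is_product_0 conj_by_def EO_carrier)
next
  case (Suc m)
  then obtain g C where "g \<in> elem_conjugates n \<sigma>" "is_product_of_elem_conjugates n m \<sigma> C"
    "A = g \<otimes>\<^bsub>O_group n\<^esub> C" by (auto simp: is_product_Suc)
  with Suc.IH[of C] \<epsilon> elem_conjugates_conj_by[OF \<sigma> \<epsilon>] show ?case
    by (auto simp: is_product_Suc conj_by_mult EO_carrier elem_conj_carrier is_product_carrier)
qed

text \<open>The commutator is \<open>A\<close> times a conjugate of its inverse, and neither
  inversion nor conjugation changes the number of factors.\<close>

lemma is_product_commutator:
  assumes "is_product_of_elem_conjugates n m \<sigma> A" "\<epsilon> \<in> EO n"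
  shows "is_product_of_elem_conjugates n (m + m) \<sigma>
    (A \<otimes>\<^bsub>O_group n\<^esub> conj_by (O_group n) \<epsilon> (inv\<^bsub>O_group n\<^esub> A))"
  using assms by (intro is_product_mult is_product_conj_by is_product_inv)

lemma self_elem_conjugates: "\<sigma> \<in> elem_conjugates n \<sigma>"
proof -
  have "\<sigma> = conj_by (O_group n) \<one>\<^bsub>O_group n\<^esub> \<sigma>" using \<sigma> by simp
  then show ?thesis using EO_closed(3) unfolding elem_conjugates_def by blast
qed

lemma is_product_transvection_add:
  assumes "k \<in> Omega n" "l \<in> Omega n" "k \<noteq> l" "k \<noteq> - l"
    and "is_product_of_elem_conjugates n m \<sigma> (transvection n k l x)"
    and "is_product_of_elem_conjugates n m' \<sigma> (transvection n k l y)"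
  shows "is_product_of_elem_conjugates n (m + m') \<sigma> (transvection n k l (x + y))"
  using is_product_mult[OF assms(5,6)] assms(1-4) by (simp add: O_group_simps transvection_add)

lemma is_product_transvection_uminus:
  assumes "k \<in> Omega n" "l \<in> Omega n" "k \<noteq> l" "k \<noteq> - l"
    and "is_product_of_elem_conjugates n m \<sigma> (transvection n k l x)"
  shows "is_product_of_elem_conjugates n m \<sigma> (transvection n k l (- x))"
  using is_product_inv[OF assms(5)] assms(1-4) by (simp add: inv_transvection)

text \<open>Realizes the Weyl group element exchanging \<open>l\<close> and \<open>j\<close>, without its sign.\<close>

lemma is_product_transvection_col_step:
  assumes ind: "k \<in> Omega n" "l \<in> Omega n" "j \<in> Omega n"
    and neq: "k \<noteq> l" "k \<noteq> - l" "j \<noteq> k" "j \<noteq> - k" "j \<noteq> l" "j \<noteq> - l"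
    and kl: "is_product_of_elem_conjugates n m \<sigma> (transvection n k l x)"
  shows "is_product_of_elem_conjugates n m \<sigma> (transvection n k j x)"
proof -
  let ?T = "transvection n :: int \<Rightarrow> int \<Rightarrow> 'a \<Rightarrow> 'a mat"
  have neq': "l \<noteq> j" "l \<noteq> - j" "k \<noteq> j" "k \<noteq> - j" "l \<noteq> k" "l \<noteq> - k" using neq by auto
  have T: "?T a b z \<in> carrier (O_group n)" if "a \<in> {k, l, j}" "b \<in> {k, l, j}" "a \<noteq> b" for a b z
    using that ind neq neq' by (auto intro!: transvection_O_group)
  \<comment> \<open>The parameter \<open>- 1\<close> offsets the sign in
    \<open>conj_by_transvection\<close>.\<close>
  have "conj_by (O_group n) (?T l j (- 1)) (?T k l x) = ?T k j x \<otimes>\<^bsub>O_group n\<^esub> ?T k l x"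
    using conj_by_transvection[of k n l j "- 1" x] ind neq neq' by simp
  with is_product_conj_by[OF transvection_EO kl, of l j "- 1"]
  have "is_product_of_elem_conjugates n m \<sigma> (?T k j x \<otimes>\<^bsub>O_group n\<^esub> ?T k l x)"
    using ind neq' by simp
  \<comment> \<open>The second conjugation puts \<open>?T k l (- x)\<close> in front of
    \<open>?T k j x\<close>, which cancels the surplus factor \<open>?T k l x\<close>.\<close>
  then have "is_product_of_elem_conjugates n m \<sigma>
      (conj_by (O_group n) (?T j l 1) (?T k j x \<otimes>\<^bsub>O_group n\<^esub> ?T k l x))"
    using ind neq by (intro is_product_conj_by transvection_EO)
  also have "conj_by (O_group n) (?T j l 1) (?T k j x \<otimes>\<^bsub>O_group n\<^esub> ?T k l x) =
      ?T k l (- x) \<otimes>\<^bsub>O_group n\<^esub> ?T k j x \<otimes>\<^bsub>O_group n\<^esub> conj_by (O_group n) (?T j l 1) (?T k l x)"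
    using conj_by_transvection[of k n j l 1 x] ind neq neq' by (simp add: conj_by_mult T)
  also have "conj_by (O_group n) (?T j l 1) (?T k l x) = ?T k l x"
    by (rule conj_by_eqI)
      (use ind neq neq' in \<open>auto intro!: T transvection_commute simp: O_group_simps\<close>)
  also have "?T k l (- x) \<otimes>\<^bsub>O_group n\<^esub> ?T k j x \<otimes>\<^bsub>O_group n\<^esub> ?T k l x =
      ?T k l (- x) \<otimes>\<^bsub>O_group n\<^esub> (?T k l x \<otimes>\<^bsub>O_group n\<^esub> ?T k j x)"
  proof -
    have "?T k j x \<otimes>\<^bsub>O_group n\<^esub> ?T k l x = ?T k l x \<otimes>\<^bsub>O_group n\<^esub> ?T k j x"
      using ind neq neq' by (auto intro!: transvection_commute simp: O_group_simps)
    then show ?thesis using neq' by (simp add: m_assoc T neq)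
  qed
  also have "\<dots> = ?T k j x"
  proof -
    have "?T k l (- x) = inv\<^bsub>O_group n\<^esub> (?T k l x)"
      using ind neq by (simp add: inv_transvection)
    then show ?thesis using neq neq' by (simp add: T)
  qed
  finally show ?thesis .
qed

end

text \<open>A single step needs old and new columns that are neither equal nor opposite. Otherwise
  the move makes a detour through a third index \<open>d\<close>.\<close>

lemma is_product_transvection_col:
  fixes \<sigma> :: "'a::comm_ring_1 mat"
  assumes n: "n \<ge> 3" and \<sigma>: "\<sigma> \<in> carrier (O_group n)"
    and ind: "k \<in> Omega n" "l \<in> Omega n" "m \<in> Omega n"
    and neq: "k \<noteq> l" "k \<noteq> - l" "k \<noteq> m" "k \<noteq> - m"
    and kl: "is_product_of_elem_conjugates n p \<sigma> (transvection n k l x)"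
  shows "is_product_of_elem_conjugates n p \<sigma> (transvection n k m x)"
proof (cases "m = l \<or> m = - l")
  case False
  then show ?thesis
    using ind neq by (intro is_product_transvection_col_step[OF \<sigma> ind(1,2,3) _ _ _ _ _ _ kl]) auto
next
  case True
  obtain d where d: "d \<in> Omega n" "d \<noteq> k" "d \<noteq> - k" "d \<noteq> l" "d \<noteq> - l"
    using exists_Omega_avoiding[OF n] .
  have kd: "is_product_of_elem_conjugates n p \<sigma> (transvection n k d x)"
    using d ind neq by (intro is_product_transvection_col_step[OF \<sigma> ind(1,2) d(1) _ _ _ _ _ _ kl]) auto
  show ?thesis
    using d ind neq True
    by (intro is_product_transvection_col_step[OF \<sigma> ind(1) d(1) ind(3) _ _ _ _ _ _ kd]) auto
qed

text \<open>By \<open>transvection_uminus\<close> a change of row is a change of column for the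
  negated indices.\<close>

lemma is_product_transvection_row:
  fixes \<sigma> :: "'a::comm_ring_1 mat"
  assumes n: "n \<ge> 3" and \<sigma>: "\<sigma> \<in> carrier (O_group n)"
    and ind: "k \<in> Omega n" "l \<in> Omega n" "m \<in> Omega n"
    and neq: "k \<noteq> l" "k \<noteq> - l" "m \<noteq> l" "m \<noteq> - l"
    and kl: "is_product_of_elem_conjugates n p \<sigma> (transvection n k l x)"
  shows "is_product_of_elem_conjugates n p \<sigma> (transvection n m l x)"
proof -
  have "is_product_of_elem_conjugates n p \<sigma> (transvection n (- l) (- k) (- x))"
    using kl by (subst (asm) transvection_uminus)
  then have "is_product_of_elem_conjugates n p \<sigma> (transvection n (- l) (- m) (- x))"
    using ind neq by (intro is_product_transvection_col[OF n \<sigma>, of "- l" "- k" "- m"]) auto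
  then show ?thesis by (subst (asm) transvection_uminus) simp
qed

text \<open>The column is first parked at an index \<open>d\<close> compatible with both rows; then
  the row changes, and finally the column goes to \<open>l\<close>.\<close>

lemma is_product_transvection_move:
  fixes \<sigma> :: "'a::comm_ring_1 mat"
  assumes n: "n \<ge> 3" and \<sigma>: "\<sigma> \<in> carrier (O_group n)"
    and ind: "i \<in> Omega n" "j \<in> Omega n" "k \<in> Omega n" "l \<in> Omega n"
    and neq: "i \<noteq> j" "i \<noteq> - j" "k \<noteq> l" "k \<noteq> - l"
    and ij: "is_product_of_elem_conjugates n p \<sigma> (transvection n i j x)"
  shows "is_product_of_elem_conjugates n p \<sigma> (transvection n k l x)"
proof -
  obtain d where d: "d \<in> Omega n" "d \<noteq> i" "d \<noteq> - i" "d \<noteq> k" "d \<noteq> - k"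
    using exists_Omega_avoiding[OF n] .
  have d': "i \<noteq> d" "i \<noteq> - d" "k \<noteq> d" "k \<noteq> - d" using d by auto
  have "is_product_of_elem_conjugates n p \<sigma> (transvection n i d x)"
    using is_product_transvection_col[OF n \<sigma> ind(1,2) d(1) neq(1,2) d'(1,2) ij] .
  then have "is_product_of_elem_conjugates n p \<sigma> (transvection n k d x)"
    by (rule is_product_transvection_row[OF n \<sigma> ind(1) d(1) ind(3) d'])
  then show ?thesis
    by (rule is_product_transvection_col[OF n \<sigma> ind(3) d(1) ind(4) d'(3,4) neq(3,4)])
qed

subsection \<open>Extracting entries\<close>

lemma is_product_entry:
  fixes \<sigma> :: "'a::comm_ring_1 mat"
  assumes n: "n \<ge> 3" and \<sigma>: "\<sigma> \<in> carrier (O_group n)"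
    and ind: "i \<in> Omega n" "j \<in> Omega n" "k \<in> Omega n" "l \<in> Omega n"
    and neq: "i \<noteq> j" "i \<noteq> - j" "k \<noteq> l" "k \<noteq> - l"
  shows "is_product_of_elem_conjugates n 8 \<sigma> (transvection n k l (entry n \<sigma> i j))"
proof -
  interpret group "O_group n :: 'a mat monoid" by (rule O_group_group)
  let ?G = "O_group n :: 'a mat monoid"
  let ?T = "transvection n :: int \<Rightarrow> int \<Rightarrow> 'a \<Rightarrow> 'a mat"
  obtain d where d: "d \<in> Omega n" "d \<noteq> i" "d \<noteq> - i" "d \<noteq> j" "d \<noteq> - j"
    using exists_Omega_avoiding[OF n] .
  have neq': "- i \<noteq> j" "- j \<noteq> i" "j \<noteq> i" "j \<noteq> - i" "i \<noteq> d" "i \<noteq> - d" "j \<noteq> d" "j \<noteq> - d"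
    "- d \<noteq> i" "- d \<noteq> j" "- i \<noteq> d" "- j \<noteq> d"
    using neq d by auto
  note facts = ind(1,2) d neq neq' Omega_nonzero[OF ind(1)] Omega_nonzero[OF ind(2)]
    Omega_nonzero[OF d(1)]
  let ?s = "entry n \<sigma> i j"
  define t1 t2 t3 where "t1 = ?T j (- d) (entry n \<sigma> i i)" and "t2 = ?T d (- i) ?s"
    and "t3 = ?T i (- j) (entry n \<sigma> i d)"
  define t where "t = t1 \<otimes>\<^bsub>?G\<^esub> (t2 \<otimes>\<^bsub>?G\<^esub> t3)"
  \<comment> \<open>Of these \<open>e\<close>, \<open>c\<close> and \<open>f\<close> lie in the
    unipotent radical of the stabilizer of \<open>e_(-i)\<close>. The element \<open>d'\<close> is
    the commutator of \<open>inv e\<close> with \<open>t2\<close>, and \<open>f\<close> is that of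
    \<open>d'\<close> with \<open>c\<close>.\<close>
  define e c d' f where "e = ?T (- i) (- j) 1" and "c = ?T (- i) j 1"
    and "d' = ?T j (- d) (- ?s)" and "f = ?T (- i) (- d) ?s"
  note defs = t1_def t2_def t3_def e_def c_def d'_def f_def
  have EO: "t1 \<in> EO n" "t2 \<in> EO n" "t3 \<in> EO n" "e \<in> EO n" "c \<in> EO n" "d' \<in> EO n" "f \<in> EO n"
    unfolding defs by (rule transvection_EO; simp add: facts)+
  then have tEO: "t \<in> EO n" unfolding t_def by (intro EO_closed)
  note [simp] = \<sigma> EO[THEN EO_carrier] tEO[THEN EO_carrier]
  define \<rho> where "\<rho> = \<sigma> \<otimes>\<^bsub>?G\<^esub> t \<otimes>\<^bsub>?G\<^esub> inv\<^bsub>?G\<^esub> \<sigma>"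
  have \<rho>[simp]: "\<rho> \<in> carrier ?G" by (simp add: \<rho>_def)
  have inv_e: "inv\<^bsub>?G\<^esub> e = ?T j i 1"
    unfolding e_def using facts by (simp add: inv_transvection transvection_uminus[of n j i])
  have et1: "inv\<^bsub>?G\<^esub> e \<otimes>\<^bsub>?G\<^esub> t1 = t1 \<otimes>\<^bsub>?G\<^esub> inv\<^bsub>?G\<^esub> e"
    unfolding inv_e t1_def O_group_simps using facts by (intro transvection_commute) auto
  \<comment> \<open>Only \<open>t2\<close> fails to commute with \<open>inv e\<close>: read as
    \<open>?T i (- d) (- ?s)\<close>, its row meets the column \<open>i\<close> of
    \<open>inv e\<close>, and the Steinberg relation produces \<open>d'\<close>.\<close>
  have et2: "inv\<^bsub>?G\<^esub> e \<otimes>\<^bsub>?G\<^esub> t2 = d' \<otimes>\<^bsub>?G\<^esub> (t2 \<otimes>\<^bsub>?G\<^esub> inv\<^bsub>?G\<^esub> e)"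
    unfolding inv_e t2_def d'_def O_group_simps transvection_uminus[of n d "- i"]
    using facts transvection_steinberg[of j n i "- d" 1 "- ?s"] by simp
  have et3: "inv\<^bsub>?G\<^esub> e \<otimes>\<^bsub>?G\<^esub> t3 = t3 \<otimes>\<^bsub>?G\<^esub> inv\<^bsub>?G\<^esub> e"
    unfolding inv_e t3_def O_group_simps using facts by (intro transvection_commute_opposite) auto
  have d't2: "d' \<otimes>\<^bsub>?G\<^esub> t2 = t2 \<otimes>\<^bsub>?G\<^esub> d'" and d't3: "d' \<otimes>\<^bsub>?G\<^esub> t3 = t3 \<otimes>\<^bsub>?G\<^esub> d'"
    unfolding d'_def t2_def t3_def O_group_simps using facts by (auto intro!: transvection_commute)
  have et: "inv\<^bsub>?G\<^esub> e \<otimes>\<^bsub>?G\<^esub> t = t \<otimes>\<^bsub>?G\<^esub> (d' \<otimes>\<^bsub>?G\<^esub> inv\<^bsub>?G\<^esub> e)"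
  proof -
    have "inv\<^bsub>?G\<^esub> e \<otimes>\<^bsub>?G\<^esub> t = t1 \<otimes>\<^bsub>?G\<^esub> (inv\<^bsub>?G\<^esub> e \<otimes>\<^bsub>?G\<^esub> t2 \<otimes>\<^bsub>?G\<^esub> t3)"
      using et1 by (simp add: t_def m_assoc[symmetric])
    also have "\<dots> = t1 \<otimes>\<^bsub>?G\<^esub> (d' \<otimes>\<^bsub>?G\<^esub> t2 \<otimes>\<^bsub>?G\<^esub> (inv\<^bsub>?G\<^esub> e \<otimes>\<^bsub>?G\<^esub> t3))"
      by (simp add: et2 m_assoc)
    also have "\<dots> = t1 \<otimes>\<^bsub>?G\<^esub> (t2 \<otimes>\<^bsub>?G\<^esub> (d' \<otimes>\<^bsub>?G\<^esub> t3 \<otimes>\<^bsub>?G\<^esub> inv\<^bsub>?G\<^esub> e))"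
      by (simp add: et3 d't2 m_assoc)
    also have "\<dots> = t \<otimes>\<^bsub>?G\<^esub> (d' \<otimes>\<^bsub>?G\<^esub> inv\<^bsub>?G\<^esub> e)"
      by (simp add: d't3 m_assoc t_def)
    finally show ?thesis .
  qed
  have dc: "d' \<otimes>\<^bsub>?G\<^esub> c = f \<otimes>\<^bsub>?G\<^esub> (c \<otimes>\<^bsub>?G\<^esub> d')"
  proof -
    \<comment> \<open>The Steinberg relation gives the commutator of \<open>c\<close> and
      \<open>d'\<close> with parameter \<open>- ?s\<close>, which is the inverse of
      \<open>f\<close>.\<close>
    have "c \<otimes>\<^bsub>?G\<^esub> d' = inv\<^bsub>?G\<^esub> f \<otimes>\<^bsub>?G\<^esub> (d' \<otimes>\<^bsub>?G\<^esub> c)"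
      unfolding c_def d'_def f_def
      using facts transvection_steinberg[of "- i" n j "- d" 1 "- ?s"]
      by (simp add: inv_transvection O_group_simps)
    then show ?thesis by simp
  qed
  have ce: "c \<otimes>\<^bsub>?G\<^esub> e = e \<otimes>\<^bsub>?G\<^esub> c"
    using facts transvection_commute_opposite[of "- i" n j 1 "- 1"]
    unfolding c_def e_def O_group_simps transvection_uminus[of n "- i" "- j"] by simp
  have cS: "\<sigma> \<in> carrier_mat (2 * n) (2 * n)"
    and cI: "inv\<^bsub>?G\<^esub> \<sigma> \<in> carrier_mat (2 * n) (2 * n)"
    by (auto intro!: O_group_carrier_mat)
  text \<open>\<open>t - 1\<close> is the contraction of a trivector of \<open>e\<^sub>i, e\<^sub>j, e\<^sub>d\<close> with row \<open>i\<close> of \<open>\<sigma>\<close>, and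
    contracting with that row once more gives zero; so \<open>t\<close> fixes \<open>\<sigma>\<^sup>-\<^sup>1 e\<^sub>-\<^sub>i\<close>.\<close>
  have fixes_col: "entry n (t \<otimes>\<^bsub>?G\<^esub> inv\<^bsub>?G\<^esub> \<sigma>) r (- i) = entry n (inv\<^bsub>?G\<^esub> \<sigma>) r (- i)"
    if r: "r \<in> Omega n" for r
  proof -
    have J: "entry n (inv\<^bsub>?G\<^esub> \<sigma>) s (- i) = entry n \<sigma> i (- s)" if "s \<in> Omega n" for s
      using entry_inv_O_group[OF \<sigma> that, of "- i"] ind by simp
    have "t \<otimes>\<^bsub>?G\<^esub> inv\<^bsub>?G\<^esub> \<sigma> = t1 \<otimes>\<^bsub>?G\<^esub> (t2 \<otimes>\<^bsub>?G\<^esub> (t3 \<otimes>\<^bsub>?G\<^esub> inv\<^bsub>?G\<^esub> \<sigma>))"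
      by (simp add: t_def m_assoc)
    moreover have "entry n \<dots> r (- i) = entry n (inv\<^bsub>?G\<^esub> \<sigma>) r (- i)"
    proof -
      \<comment> \<open>The factors of \<open>t\<close> alter only the rows \<open>i\<close>,
        \<open>j\<close>, \<open>d\<close> and read only the rows \<open>- i\<close>,
        \<open>- j\<close>, \<open>- d\<close>. Each altered row receives two corrections, which
        cancel in column \<open>- i\<close>.\<close>
      consider "r = i" | "r = j" | "r = d" | "r \<noteq> i" "r \<noteq> j" "r \<noteq> d" by blast
      then show ?thesis
        unfolding t1_def t2_def t3_def O_group_simps
        by cases (simp_all add: r facts entry_transvection_mult cI J)
    qed
    ultimately show ?thesis by simp
  qed
  have \<rho>_col: "entry n \<rho> r (- i) = (if r = - i then 1 else 0)" if r: "r \<in> Omega n" for r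
  proof -
    have cTI: "t \<otimes>\<^bsub>?G\<^esub> inv\<^bsub>?G\<^esub> \<sigma> \<in> carrier_mat (2 * n) (2 * n)"
      by (rule O_group_carrier_mat) simp
    have "entry n \<rho> r (- i) = entry n (\<sigma> * (t \<otimes>\<^bsub>?G\<^esub> inv\<^bsub>?G\<^esub> \<sigma>)) r (- i)"
      by (simp add: \<rho>_def m_assoc) (simp add: O_group_simps)
    also have "\<dots> = entry n (\<sigma> * inv\<^bsub>?G\<^esub> \<sigma>) r (- i)"
      using r ind by (simp add: entry_mult[OF cS cTI] entry_mult[OF cS cI] fixes_col)
    also have "\<sigma> * inv\<^bsub>?G\<^esub> \<sigma> = 1\<^sub>m (2 * n)"
      using r_inv[OF \<sigma>] by (simp only: O_group_simps)
    finally show ?thesis using r ind by simp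
  qed
  \<comment> \<open>Needed twice: \<open>m = j\<close> gives commutation with \<open>c\<close>, and
    \<open>m = - d\<close> commutation with \<open>f\<close>.\<close>
  have b: "inv\<^bsub>?G\<^esub> \<rho> \<otimes>\<^bsub>?G\<^esub> (e \<otimes>\<^bsub>?G\<^esub> \<rho>) \<otimes>\<^bsub>?G\<^esub> ?T (- i) m y =
      ?T (- i) m y \<otimes>\<^bsub>?G\<^esub> (inv\<^bsub>?G\<^esub> \<rho> \<otimes>\<^bsub>?G\<^esub> (e \<otimes>\<^bsub>?G\<^esub> \<rho>))"
    if "m \<in> Omega n" "m \<noteq> i" "m \<noteq> - i" for m y
    unfolding O_group_simps e_def
    by (rule conj_transvection_commute[OF \<rho>]) (use that facts \<rho>_col in auto)
  define x where "x = conj_by ?G t \<sigma> \<otimes>\<^bsub>?G\<^esub> inv\<^bsub>?G\<^esub> \<sigma>"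
  define y where "y = conj_by ?G (inv\<^bsub>?G\<^esub> t) (x \<otimes>\<^bsub>?G\<^esub> conj_by ?G e (inv\<^bsub>?G\<^esub> x))"
  have "y \<otimes>\<^bsub>?G\<^esub> conj_by ?G c (inv\<^bsub>?G\<^esub> y) = f"
    unfolding y_def x_def
    by (rule iterated_commutator[OF _ _ _ _ _ _ et dc ce])
      (use b[of j 1, folded c_def] b[of "- d" ?s, folded f_def] facts in \<open>simp_all flip: \<rho>_def\<close>)
  moreover have "is_product_of_elem_conjugates n 8 \<sigma> (y \<otimes>\<^bsub>?G\<^esub> conj_by ?G c (inv\<^bsub>?G\<^esub> y))"
  proof -
    have single: "is_product_of_elem_conjugates n 1 \<sigma> \<sigma>"
      by (rule is_product_single[OF \<sigma> self_elem_conjugates[OF \<sigma>]])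
    \<comment> \<open>In \<open>x\<close> the conjugate precedes the inverse, the opposite order to
      \<open>is_product_commutator\<close>, so this product is assembled by hand.\<close>
    have "is_product_of_elem_conjugates n (1 + 1) \<sigma> x"
      unfolding x_def
      by (rule is_product_mult[OF \<sigma> is_product_conj_by[OF \<sigma> tEO single] is_product_inv[OF \<sigma> single]])
    from is_product_conj_by[OF \<sigma> EO_closed(2)[OF tEO] is_product_commutator[OF \<sigma> this EO(4)]]
    have "is_product_of_elem_conjugates n (1 + 1 + (1 + 1)) \<sigma> y"
      unfolding y_def .
    from is_product_commutator[OF \<sigma> this EO(5)] show ?thesis by (simp add: eval_nat_numeral)
  qed
  ultimately have "is_product_of_elem_conjugates n 8 \<sigma> (?T (- i) (- d) ?s)"
    by (simp add: f_def)
  then show ?thesis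
    by (rule is_product_transvection_move[OF n \<sigma> _ _ ind(3,4) _ _ neq(3,4), rotated -1])
      (simp_all add: facts)
qed

text \<open>The conjugation adds row \<open>i\<close> to row \<open>j\<close> and subtracts column
  \<open>j\<close> from column \<open>i\<close>. Entries at \<open>(i, - i)\<close>,
  \<open>(i, i)\<close> and \<open>(j, j)\<close> thus enter positions to which
  \<open>is_product_entry\<close> applies.\<close>

lemma entry_conj_by_transvection:
  fixes \<sigma> :: "'a::comm_ring_1 mat"
  assumes \<sigma>: "\<sigma> \<in> carrier (O_group n)"
    and ind: "i \<in> Omega n" "j \<in> Omega n" and neq: "i \<noteq> j" "i \<noteq> - j"
  defines "\<sigma>' \<equiv> conj_by (O_group n) (transvection n j i 1) \<sigma>"
  shows "entry n \<sigma>' j (- i) = entry n \<sigma> j (- i) + entry n \<sigma> i (- i)"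
    and "entry n \<sigma>' j i = entry n \<sigma> j i + entry n \<sigma> i i - (entry n \<sigma> j j + entry n \<sigma> i j)"
proof -
  have neq': "j \<noteq> i" "j \<noteq> - i" "- i \<noteq> j" "- j \<noteq> i" using neq by auto
  have "\<sigma>' = transvection n j i 1 * \<sigma> * transvection n j i (- 1)"
    using ind neq' by (simp add: \<sigma>'_def conj_by_def inv_transvection O_group_simps)
  moreover note entry_mult_transvection[OF ind(2,1) _ _ transvection_mult_carrier[OF O_group_carrier_mat[OF \<sigma>]]]
    entry_transvection_mult[OF ind(2,1) _ _ O_group_carrier_mat[OF \<sigma>]]
  ultimately show "entry n \<sigma>' j (- i) = entry n \<sigma> j (- i) + entry n \<sigma> i (- i)"
    and "entry n \<sigma>' j i = entry n \<sigma> j i + entry n \<sigma> i i - (entry n \<sigma> j j + entry n \<sigma> i j)"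
    using ind neq neq' Omega_nonzero[OF ind(1)] by simp_all
qed

text \<open>Solving \<open>entry_conj_by_transvection\<close> for the wanted terms leaves two
  entries covered by \<open>is_product_entry\<close> in the first case and three in the second, at 8
  factors each.\<close>

lemma is_product_diagonal_entries:
  fixes \<sigma> :: "'a::comm_ring_1 mat"
  assumes n: "n \<ge> 3" and \<sigma>: "\<sigma> \<in> carrier (O_group n)"
    and ind: "i \<in> Omega n" "j \<in> Omega n" "k \<in> Omega n" "l \<in> Omega n"
    and neq: "i \<noteq> j" "i \<noteq> - j" "k \<noteq> l" "k \<noteq> - l"
  shows "is_product_of_elem_conjugates n 16 \<sigma> (transvection n k l (entry n \<sigma> i (- i)))"
    and "is_product_of_elem_conjugates n 24 \<sigma>
      (transvection n k l (entry n \<sigma> i i - entry n \<sigma> j j))"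
proof -
  interpret group "O_group n :: 'a mat monoid" by (rule O_group_group)
  define \<sigma>' where "\<sigma>' = conj_by (O_group n) (transvection n j i 1) \<sigma>"
  have neq': "j \<noteq> i" "j \<noteq> - i" "j \<noteq> - (- i)" using neq by auto
  have EO: "transvection n j i (1 :: 'a) \<in> EO n" using ind neq' by (intro transvection_EO)
  have \<sigma>': "\<sigma>' \<in> carrier (O_group n)" using \<sigma> EO by (simp add: \<sigma>'_def EO_carrier)
  note mono = is_product_mono[OF _ elem_conjugates_of_conj_by[OF \<sigma> EO], folded \<sigma>'_def]
  note entries = entry_conj_by_transvection[OF \<sigma> ind(1,2) neq(1,2), folded \<sigma>'_def]
  note T_add = is_product_transvection_add[OF \<sigma> ind(3,4) neq(3,4)]
  note T_uminus = is_product_transvection_uminus[OF \<sigma> ind(3,4) neq(3,4)]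
  have "is_product_of_elem_conjugates n 8 \<sigma> (transvection n k l (entry n \<sigma>' j (- i)))"
    using ind neq neq' by (intro mono is_product_entry[OF n \<sigma>']) auto
  moreover have "is_product_of_elem_conjugates n 8 \<sigma> (transvection n k l (- entry n \<sigma> j (- i)))"
    using ind neq neq' by (intro T_uminus is_product_entry[OF n \<sigma>]) auto
  ultimately have "is_product_of_elem_conjugates n (8 + 8) \<sigma>
      (transvection n k l (entry n \<sigma>' j (- i) + - entry n \<sigma> j (- i)))"
    by (rule T_add)
  then show "is_product_of_elem_conjugates n 16 \<sigma> (transvection n k l (entry n \<sigma> i (- i)))"
    by (simp add: entries)
  have "is_product_of_elem_conjugates n 8 \<sigma> (transvection n k l (entry n \<sigma>' j i))"
    using ind neq neq' by (intro mono is_product_entry[OF n \<sigma>']) auto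
  moreover have "is_product_of_elem_conjugates n 8 \<sigma> (transvection n k l (- entry n \<sigma> j i))"
    using ind neq neq' by (intro T_uminus is_product_entry[OF n \<sigma>]) auto
  ultimately have "is_product_of_elem_conjugates n (8 + 8) \<sigma>
      (transvection n k l (entry n \<sigma>' j i + - entry n \<sigma> j i))"
    by (rule T_add)
  moreover have "is_product_of_elem_conjugates n 8 \<sigma> (transvection n k l (entry n \<sigma> i j))"
    using ind neq by (intro is_product_entry[OF n \<sigma>])
  ultimately have "is_product_of_elem_conjugates n (8 + 8 + 8) \<sigma>
      (transvection n k l (entry n \<sigma>' j i + - entry n \<sigma> j i + entry n \<sigma> i j))"
    by (rule T_add)
  then show "is_product_of_elem_conjugates n 24 \<sigma>
      (transvection n k l (entry n \<sigma> i i - entry n \<sigma> j j))"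
    by (simp add: entries algebra_simps)
qed

theorem theorem27:
  fixes n :: nat and \<sigma> :: "'a::comm_ring_1 mat" and i j k l :: int
  assumes "n \<ge> 3"
    and "\<sigma> \<in> carrier (O_group n)"
    and "i \<in> Omega n" and "j \<in> Omega n" and "k \<in> Omega n" and "l \<in> Omega n"
    and "i \<noteq> j" and "i \<noteq> - j" and "k \<noteq> l" and "k \<noteq> - l"
  shows "is_product_of_elem_conjugates n 8 \<sigma> (transvection n k l (entry n \<sigma> i j)) \<and>
    is_product_of_elem_conjugates n 16 \<sigma> (transvection n k l (entry n \<sigma> i (- i))) \<and>
    is_product_of_elem_conjugates n 24 \<sigma>
      (transvection n k l (entry n \<sigma> i i - entry n \<sigma> j j)) \<and>
    is_product_of_elem_conjugates n 48 \<sigma>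
      (transvection n k l (entry n \<sigma> i i - entry n \<sigma> (- i) (- i)))"
proof -
  note kl = assms(5,6,9,10)
  have "is_product_of_elem_conjugates n 24 \<sigma>
      (transvection n k l (entry n \<sigma> i i - entry n \<sigma> j j))"
    using assms by (intro is_product_diagonal_entries(2))
  \<comment> \<open>The indices \<open>i\<close> and \<open>- i\<close> are not an admissible pair
    for the previous lemma, so the difference telescopes through \<open>j\<close>.\<close>
  moreover have "is_product_of_elem_conjugates n 24 \<sigma>
      (transvection n k l (entry n \<sigma> j j - entry n \<sigma> (- i) (- i)))"
    using assms by (intro is_product_diagonal_entries(2)) auto
  ultimately have "is_product_of_elem_conjugates n (24 + 24) \<sigma> (transvection n k l
      (entry n \<sigma> i i - entry n \<sigma> j j + (entry n \<sigma> j j - entry n \<sigma> (- i) (- i))))"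
    by (rule is_product_transvection_add[OF assms(2) kl])
  then have "is_product_of_elem_conjugates n 48 \<sigma>
      (transvection n k l (entry n \<sigma> i i - entry n \<sigma> (- i) (- i)))"
    by simp
  then show ?thesis
    using is_product_entry[OF assms] is_product_diagonal_entries[OF assms] by blast
qed

end
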